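(* Let $R$ be a supertropical domain and let $A\in M_n(R)$ with $|A|$ invertible in $R$. Define $A^{\nabla}=\frac{1_R}{|A|}\operatorname{adj}(A)$, $A^{\hat\nabla}=\frac{1_R}{|A|}\widehat{\operatorname{adj}(A)}$. Then $AA^{\nabla}=AA^{\hat\nabla}$ and $A^{\nabla}A=A^{\hat\nabla}A$, and both of the matrices $I_A:=AA^{\nabla}=AA^{\hat\nabla}$ and $I'_A:=A^{\nabla}A=A^{\hat\nabla}A$ are quasi-identity matrices.
   Context: A semiring with ghosts is a triple $(R,\mathcal G_0,\nu)$ where $R$ is a semiring with zero $0_R$ and unit $1_R$, $\mathcal G_0=\mathcal G\cup\{0_R\}$ is a semiring ideal (the ghost ideal, whose elements are called ghost), and $\nu:R\to\mathcal G_0$, $\nu(a)=a+a$ (written $a^\nu$), is an idempotent semiring homomorphism. It is a supertropical semiring if $a+b=a^\nu$ whenever $a^\nu=b^\nu$, and $a+b\in\{a,b\}$ whenever $a^\nu\ne b^\nu$ (equivalently, $\mathcal G_0$ is totally ordered via $a^\nu\le b^\nu$ iff $a^\nu+b^\nu=b^\nu$). A supertropical domain is a commutative supertropical semiring such that $\mathcal T=R\setminus\mathcal G_0$ (the tangible elements) is a monoid under multiplication and $\nu|_{\mathcal T}:\mathcal T\to\mathcal G$ is onto. Put $\mathcal T_0=\mathcal T\cup\{0_R\}$. A tangible retract function is fixed: a map $R\to\mathcal T_0$, $b\mapsto\hat b$, which is the identity on $\mathcal T_0$ and satisfies $(\hat b)^\nu=b$ for all $b\in\mathcal G_0$. For $A=(a_{i,j})\in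 M_n(R)$, $|A|=\sum_{\sigma\in S_n}a_{1,\sigma(1)}\cdots a_{n,\sigma(n)}$ (the permanent), $A_{i,j}$ is obtained by deleting row $i$ and column $j$, $\operatorname{adj}(A)$ has $(i,j)$ entry $|A_{j,i}|$ (the empty determinant is $1_R$), and the tangible adjoint $\widehat{\operatorname{adj}(A)}$ has $(i,j)$ entry $\widehat{|A_{j,i}|}$. A matrix is nonsingular if its determinant $|\cdot|$ is tangible and invertible. A quasi-identity matrix is a nonsingular, multiplicatively idempotent matrix equal to the identity matrix $I$ on the diagonal and whose off-diagonal entries are in $\mathcal G_0$. *)

theory Defs
  imports "Jordan_Normal_Form.Determinant"
begin

definition ghost_map :: "'a::semiring_1 \<Rightarrow> 'a" where
  "ghost_map a = a + a"

(* The semiring R is the whole type and the ghost map is determined by R, so that G0 is the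
   only remaining datum of a semiring with ghosts. *)
locale semiring_with_ghosts =
  fixes G0 :: "'a::semiring_1 set"
  assumes ghost_zero: "0 \<in> G0"
    and ghost_add: "\<And>a b. a \<in> G0 \<Longrightarrow> b \<in> G0 \<Longrightarrow> a + b \<in> G0"
    and ghost_mult_left: "\<And>r a. a \<in> G0 \<Longrightarrow> r * a \<in> G0"
    and ghost_mult_right: "\<And>r a. a \<in> G0 \<Longrightarrow> a * r \<in> G0"
    and ghost_map_ghost: "\<And>a. ghost_map a \<in> G0"
    and ghost_map_zero: "ghost_map (0::'a) = 0"
    and ghost_map_add: "\<And>a b::'a. ghost_map (a + b) = ghost_map a + ghost_map b"
    and ghost_map_mult: "\<And>a b::'a. ghost_map (a * b) = ghost_map a * ghost_map b"
    and ghost_map_idem: "\<And>a::'a. ghost_map (ghost_map a) = ghost_map a"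

locale supertropical_semiring = semiring_with_ghosts G0
  for G0 :: "'a::semiring_1 set" +
  assumes add_eq_ghost: "\<And>a b::'a. ghost_map a = ghost_map b \<Longrightarrow> a + b = ghost_map a"
    and add_bipotent: "\<And>a b::'a. ghost_map a \<noteq> ghost_map b \<Longrightarrow> a + b \<in> {a, b}"

definition tangibles :: "'a set \<Rightarrow> 'a set" where
  "tangibles G0 = - G0"

(* Here G = G0 - {0}. *)
locale supertropical_domain = supertropical_semiring G0
  for G0 :: "'a::comm_semiring_1 set" +
  assumes tangible_one: "1 \<in> tangibles G0"
    and tangible_mult: "\<And>a b. a \<in> tangibles G0 \<Longrightarrow> b \<in> tangibles G0 \<Longrightarrow> a * b \<in> tangibles G0"
    and ghost_map_onto: "ghost_map ` tangibles G0 = G0 - {0}"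

definition tangible_retract :: "'a::semiring_1 set \<Rightarrow> ('a \<Rightarrow> 'a) \<Rightarrow> bool" where
  "tangible_retract G0 hat \<longleftrightarrow>
     (\<forall>b. hat b \<in> tangibles G0 \<union> {0}) \<and>
     (\<forall>b \<in> tangibles G0 \<union> {0}. hat b = b) \<and>
     (\<forall>b \<in> G0. ghost_map (hat b) = b)"

(* The supertropical determinant is the permanent; it is 1 for the 0 x 0 matrix. *)
definition sdet :: "'a::comm_semiring_1 mat \<Rightarrow> 'a" where
  "sdet A = (\<Sum>p | p permutes {0..<dim_row A}. \<Prod>i = 0..<dim_row A. A $$ (i, p i))"

definition sadj :: "'a::comm_semiring_1 mat \<Rightarrow> 'a mat" where
  "sadj A = mat (dim_row A) (dim_col A) (\<lambda>(i, j). sdet (mat_delete A j i))"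

definition tangible_sadj :: "('a \<Rightarrow> 'a) \<Rightarrow> 'a::comm_semiring_1 mat \<Rightarrow> 'a mat" where
  "tangible_sadj hat A = map_mat hat (sadj A)"

(* Meaningful only if a is invertible; the inverse is then unique. *)
definition unit_inverse :: "'a::comm_semiring_1 \<Rightarrow> 'a" where
  "unit_inverse a = (THE b. a * b = 1)"

lemma unit_inverse_eqI:
  assumes "a * b = 1"
  shows "unit_inverse a = b"
  unfolding unit_inverse_def
  using assms by (intro the_equality) (auto, metis mult.commute mult.left_commute mult_1_right)

lemma unit_inverse_right: "a dvd 1 \<Longrightarrow> a * unit_inverse a = 1"
  by (metis dvdE unit_inverse_eqI)

definition nabla :: "'a::comm_semiring_1 mat \<Rightarrow> 'a mat" where
  "nabla A = unit_inverse (sdet A) \<cdot>\<^sub>m sadj A"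

definition tangible_nabla :: "('a \<Rightarrow> 'a) \<Rightarrow> 'a::comm_semiring_1 mat \<Rightarrow> 'a mat" where
  "tangible_nabla hat A = unit_inverse (sdet A) \<cdot>\<^sub>m tangible_sadj hat A"

definition nonsingular_mat :: "'a::comm_semiring_1 set \<Rightarrow> 'a mat \<Rightarrow> bool" where
  "nonsingular_mat G0 A \<longleftrightarrow> sdet A \<in> tangibles G0 \<and> sdet A dvd 1"

definition quasi_identity :: "'a::comm_semiring_1 set \<Rightarrow> nat \<Rightarrow> 'a mat \<Rightarrow> bool" where
  "quasi_identity G0 n M \<longleftrightarrow>
     M \<in> carrier_mat n n \<and>
     nonsingular_mat G0 M \<and>
     M * M = M \<and>
     (\<forall>i < n. M $$ (i, i) = 1\<^sub>m n $$ (i, i)) \<and>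
     (\<forall>i < n. \<forall>j < n. i \<noteq> j \<longrightarrow> M $$ (i, j) \<in> G0)"

end

theory Submission
  imports Defs "HOL-Combinatorics.Cycles"
begin

text \<open>
  The elements of a supertropical semiring are totally preordered by comparing ghost images; write
  \<open>a \<preceq> b\<close> for \<open>a\<^sup>\<nu> \<le> b\<^sup>\<nu>\<close>. A finite sum is its unique largest summand if there is one,
  and is ghost if the maximum is attained twice. Hence an invertible determinant, being
  tangible, is the weight of a single permutation that strictly dominates all others.

  Put \<open>N = A adj(A)\<close>. Its \<open>(i, j)\<close> entry is the permanent of the matrix obtained from \<open>A\<close> by
  overwriting row \<open>j\<close> with row \<open>i\<close>. So the diagonal entries of \<open>N\<close> are \<open>|A|\<close>. Off the diagonal two
  rows agree, and exchanging the columns that a permutation assigns to these rows preserves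
  its weight. This ties the summands of \<open>\<Sum>\<^sub>k a\<^sub>i\<^sub>k |A\<^sub>j\<^sub>k|\<close>: none of them is a strict maximum, so the
  sum is ghost. The tie only concerns ghost images, so it persists when the minors are replaced by
  their tangible retracts; both sums are then ghosts with the same image, hence equal. On the
  diagonal the single dominating summand is tangible, so its minor is already its own retract.

  What remains is idempotency and nonsingularity of \<open>M = N / |A|\<close>, and both follow from
  \<open>m\<^sub>i\<^sub>k m\<^sub>k\<^sub>j \<preceq> m\<^sub>i\<^sub>j\<close> together with the strict inequality \<open>m\<^sub>i\<^sub>k m\<^sub>k\<^sub>i \<prec> 1\<close> for \<open>i \<noteq> k\<close>
  (\<open>quasi_identityI\<close>): in \<open>M M\<close> every summand is absorbed by the ghost \<open>m\<^sub>i\<^sub>j\<close> or by the diagonal \<open>1\<close>,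
  and in \<open>|M|\<close> every permutation but the identity has weight strictly below \<open>1\<close>.
  The two inequalities come from an exchange property of permutations (\<open>row_weight_exchange\<close>): a term
  of \<open>N\<^sub>i\<^sub>k\<close> times a term of \<open>N\<^sub>k\<^sub>j\<close> is also a term of \<open>N\<^sub>i\<^sub>j\<close> times a term of \<open>|A|\<close>. For \<open>i = j\<close>
  both are terms of \<open>|A|\<close>, belonging to different permutations; at most one of them
  is the dominating one, which makes the inequality strict.

  The claims about \<open>adj(A) A\<close> follow by transposition.
\<close>

section \<open>The order by ghost images\<close>

text \<open>
  This is the order of ghost images pulled back to all elements. It is only a preorder: a tangible
  element and its ghost image precede each other.
\<close>
definition nu_le :: "'a::semiring_1 \<Rightarrow> 'a \<Rightarrow> bool" where
  "nu_le a b \<longleftrightarrow> ghost_map a + ghost_map b = ghost_map b"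

context supertropical_semiring
begin

abbreviation le_nu :: "'a \<Rightarrow> 'a \<Rightarrow> bool"  (infix "\<preceq>" 50) where
  "a \<preceq> b \<equiv> nu_le a b"

definition nu_less :: "'a \<Rightarrow> 'a \<Rightarrow> bool"  (infix "\<prec>" 50) where
  "a \<prec> b \<longleftrightarrow> \<not> b \<preceq> a"

lemma ghost_map_add_self: "ghost_map a + ghost_map a = ghost_map (a::'a)"
  using ghost_map_idem[of a] by (simp add: ghost_map_def)

lemma nu_le_refl [simp]: "a \<preceq> a"
  by (simp add: nu_le_def ghost_map_add_self)

lemma nu_le_trans [trans]: "a \<preceq> b \<Longrightarrow> b \<preceq> c \<Longrightarrow> a \<preceq> c"
  unfolding nu_le_def by (metis add.assoc)

lemma nu_le_antisym: "a \<preceq> b \<Longrightarrow> b \<preceq> a \<Longrightarrow> ghost_map a = ghost_map b"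
  unfolding nu_le_def by (metis add.commute)

lemma nu_le_total: "a \<preceq> b \<or> b \<preceq> a"
proof (cases "ghost_map a = ghost_map b")
  case True
  then show ?thesis by (simp add: nu_le_def ghost_map_add_self)
next
  case False
  then have "ghost_map a + ghost_map b \<in> {ghost_map a, ghost_map b}"
    by (intro add_bipotent) (simp add: ghost_map_idem)
  then show ?thesis by (auto simp: nu_le_def add.commute)
qed

lemma nu_less_imp_le: "a \<prec> b \<Longrightarrow> a \<preceq> b"
  using nu_le_total by (auto simp: nu_less_def)

lemma nu_le_less_trans [trans]: "a \<preceq> b \<Longrightarrow> b \<prec> c \<Longrightarrow> a \<prec> c"
  unfolding nu_less_def using nu_le_trans by blast

lemma nu_le_cong: "ghost_map a = ghost_map b \<Longrightarrow> a \<preceq> b"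
  by (simp add: nu_le_def ghost_map_add_self)

lemma zero_nu_le [simp]: "0 \<preceq> a"
  by (simp add: nu_le_def ghost_map_zero)

lemma nu_le_ghost_map_iff [simp]: "a \<preceq> ghost_map b \<longleftrightarrow> a \<preceq> b"
  by (simp add: nu_le_def ghost_map_idem)

lemma nu_le_mult_left: "a \<preceq> b \<Longrightarrow> c * a \<preceq> c * b"
  unfolding nu_le_def ghost_map_mult by (metis distrib_left)

lemma nu_le_mult_right: "a \<preceq> b \<Longrightarrow> a * c \<preceq> b * c"
  unfolding nu_le_def ghost_map_mult by (metis distrib_right)

lemma nu_le_mult: "a \<preceq> b \<Longrightarrow> c \<preceq> d \<Longrightarrow> a * c \<preceq> b * d"
  by (meson nu_le_mult_left nu_le_mult_right nu_le_trans)

lemma nu_le_add1: "a \<preceq> a + b"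
  by (simp add: nu_le_def ghost_map_add ghost_map_add_self flip: add.assoc)

lemma nu_add_le: "a \<preceq> c \<Longrightarrow> b \<preceq> c \<Longrightarrow> a + b \<preceq> c"
  unfolding nu_le_def ghost_map_add by (metis add.assoc)

text \<open>
  A strict inequality excludes the case of equal ghost images, so bipotency makes the sum one of
  the two summands; it cannot be the smaller one, because a sum lies above each of its summands.
\<close>
lemma add_eq_right: "a \<prec> b \<Longrightarrow> a + b = b"
proof -
  assume *: "a \<prec> b"
  then have "a + b \<in> {a, b}"
    using add_bipotent nu_le_cong unfolding nu_less_def by metis
  moreover have "a + b \<noteq> a"
    using * nu_le_add1[of b a] by (auto simp: nu_less_def add.commute)
  ultimately show ?thesis by simp
qed

lemma ghost_map_sum:
  fixes f :: "'i \<Rightarrow> 'a"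
  shows "ghost_map (sum f I) = (\<Sum>i\<in>I. ghost_map (f i))"
  by (induction I rule: infinite_finite_induct) (auto simp: ghost_map_zero ghost_map_add)

lemma sum_nu_le: "(\<And>i. i \<in> I \<Longrightarrow> f i \<preceq> b) \<Longrightarrow> sum f I \<preceq> b"
  by (induction I rule: infinite_finite_induct) (auto intro: nu_add_le)

lemma member_nu_le_sum: "finite I \<Longrightarrow> i \<in> I \<Longrightarrow> f i \<preceq> sum f I"
  by (simp add: sum.remove nu_le_add1)

lemma ex_nu_max:
  assumes "finite I" "I \<noteq> {}"
  obtains k where "k \<in> I" "\<And>i. i \<in> I \<Longrightarrow> f i \<preceq> f k"
proof -
  have "\<exists>k\<in>I. \<forall>i\<in>I. f i \<preceq> f k"
    using assms
  proof (induction I rule: finite_ne_induct)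
    case (insert x F)
    then obtain k where k: "k \<in> F" "\<forall>i\<in>F. f i \<preceq> f k" by blast
    show ?case
    proof (cases "f x \<preceq> f k")
      case True
      with k show ?thesis by auto
    next
      case False
      then have "f k \<preceq> f x" using nu_le_total by blast
      with k show ?thesis by (auto intro: nu_le_trans)
    qed
  qed simp
  then show ?thesis using that by blast
qed

lemma sum_nu_less:
  assumes "finite I" "I \<noteq> {}" "\<And>i. i \<in> I \<Longrightarrow> f i \<prec> b"
  shows "sum f I \<prec> b"
  by (metis assms ex_nu_max sum_nu_le nu_le_less_trans)

lemma sum_eq_dominant:
  assumes "finite I" "k \<in> I" and less: "\<And>i. i \<in> I \<Longrightarrow> i \<noteq> k \<Longrightarrow> f i \<prec> f k"
  shows "sum f I = f k"
proof (cases "I = {k}")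
  case False
  with assms have "sum f (I - {k}) \<prec> f k" by (intro sum_nu_less) auto
  then have "sum f (I - {k}) + f k = f k" by (rule add_eq_right)
  with assms show ?thesis by (simp add: sum.remove add.commute)
qed simp

end

context supertropical_domain
begin

lemma ghost_map_of_ghost: "a \<in> G0 \<Longrightarrow> ghost_map a = a"
proof (cases "a = 0")
  case False
  assume "a \<in> G0"
  with False obtain t where "a = ghost_map t" using ghost_map_onto by blast
  then show ?thesis by (simp add: ghost_map_idem)
qed (simp add: ghost_map_zero)

lemma ghost_absorb:
  assumes "g \<in> G0" "a \<preceq> g"
  shows "a + g = g"
proof (cases "g \<preceq> a")
  case True
  with assms have "ghost_map a = ghost_map g" by (intro nu_le_antisym)
  with assms show ?thesis by (simp add: add_eq_ghost ghost_map_of_ghost)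
next
  case False
  then show ?thesis by (intro add_eq_right) (simp add: nu_less_def)
qed

text \<open>
  Two maximal summands already add up to their common ghost image, and a ghost absorbs everything
  that does not exceed it.
\<close>
lemma sum_ghost_if_tied:
  assumes "finite I" "k \<in> I" "l \<in> I" "k \<noteq> l"
    and max: "\<And>i. i \<in> I \<Longrightarrow> f i \<preceq> f k" and tie: "f k \<preceq> f l"
  shows "sum f I \<in> G0"
proof -
  have "ghost_map (f k) = ghost_map (f l)" using assms by (intro nu_le_antisym) auto
  then have kl: "f k + f l = ghost_map (f k)" by (rule add_eq_ghost)
  have "sum f I = sum f (I - {k} - {l}) + (f k + f l)"
    using assms by (simp add: sum.remove[of I k] sum.remove[of "I - {k}" l] ac_simps)
  also have "\<dots> = f k + f l"
    unfolding kl
  proof (rule ghost_absorb)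
    show "sum f (I - {k} - {l}) \<preceq> ghost_map (f k)"
      using max by (intro sum_nu_le) auto
  qed (rule ghost_map_ghost)
  finally show ?thesis using kl ghost_map_ghost by simp
qed

lemma tangible_sum_dominant:
  assumes "finite I" "sum f I \<notin> G0"
  obtains k where "k \<in> I" "sum f I = f k" "\<And>i. i \<in> I \<Longrightarrow> i \<noteq> k \<Longrightarrow> f i \<prec> f k"
proof -
  have "I \<noteq> {}" using assms ghost_zero by auto
  with assms obtain k where k: "k \<in> I" "\<And>i. i \<in> I \<Longrightarrow> f i \<preceq> f k"
    using ex_nu_max by metis
  have *: "f i \<prec> f k" if "i \<in> I" "i \<noteq> k" for i
    using that k assms sum_ghost_if_tied[of I k i f] unfolding nu_less_def by metis
  then have "sum f I = f k" using assms k by (intro sum_eq_dominant) auto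
  with * k that show ?thesis by blast
qed

text \<open>
  The contrapositive of the previous lemma, in a form that does not require knowing a maximum: it is
  enough that every summand is matched or exceeded by another one.
\<close>
lemma sum_ghost_if_no_dominant:
  assumes "finite I" and "\<And>k. k \<in> I \<Longrightarrow> \<exists>l\<in>I. l \<noteq> k \<and> f k \<preceq> f l"
  shows "sum f I \<in> G0"
  using tangible_sum_dominant[OF assms(1)] assms(2) unfolding nu_less_def by metis

lemma unit_not_ghost: "u dvd 1 \<Longrightarrow> u \<notin> G0"
  using ghost_mult_right[of u] tangible_one by (metis ComplD dvdE tangibles_def)

lemma nu_le_unit_cancel: "u * v = 1 \<Longrightarrow> u * a \<preceq> u * b \<Longrightarrow> a \<preceq> b"
  using nu_le_mult_left[of "u * a" "u * b" v] by (simp add: mult.commute[of v] flip: mult.assoc)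

lemma nu_less_mult_unit: "u dvd 1 \<Longrightarrow> a \<prec> b \<Longrightarrow> u * a \<prec> u * b"
  unfolding nu_less_def dvd_def using nu_le_unit_cancel by metis

end

section \<open>Splitting and gluing permutations\<close>

text \<open>
  Follow the orbit of \<open>k\<close> until it first meets \<open>j\<close> or returns to \<open>k\<close>. If it returns to \<open>k\<close>, the
  cycle of \<open>k\<close> avoids \<open>j\<close>. If it meets \<open>j\<close>, then exchanging the values \<open>k\<close> and \<open>j\<close> cuts the
  common cycle in two, and the traversed part becomes a cycle through \<open>k\<close> alone.
\<close>
lemma permutes_separating_set:
  assumes pi: "\<pi> permutes U" and "finite U" and "k \<in> U" and "j \<noteq> k"
  obtains S where "S \<subseteq> U" "k \<in> S" "j \<notin> S" "\<pi> ` S = S \<or> (transpose k j \<circ> \<pi>) ` S = S"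
proof -
  obtain m0 where m0: "(\<pi> ^^ m0) = id" "m0 > 0"
    using permutation_is_nilpotent permutes_imp_permutation[OF assms(2,1)] by blast
  define P where "P = (\<lambda>m. m > 0 \<and> (\<pi> ^^ m) k \<in> {j, k})"
  define m where "m = (LEAST m. P m)"
  have "P m0" using m0 by (simp add: P_def)
  then have m: "m > 0" "(\<pi> ^^ m) k \<in> {j, k}"
    unfolding m_def using LeastI[of P] by (auto simp: P_def)
  have before: "(\<pi> ^^ a) k \<notin> {j, k}" if "a > 0" "a < m" for a
    using that not_less_Least[of a P] unfolding m_def P_def by blast
  define S where "S = (\<lambda>a. (\<pi> ^^ a) k) ` {..<m}"
  have "finite S" by (simp add: S_def)
  have "S \<subseteq> U"
    using permutes_in_image[OF permutes_funpow[OF pi]] \<open>k \<in> U\<close> by (auto simp: S_def)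
  moreover have "k \<in> S" using m by (auto simp: S_def intro!: image_eqI[of _ _ 0])
  moreover have "j \<notin> S"
  proof
    assume "j \<in> S"
    then obtain a where "a < m" "(\<pi> ^^ a) k = j" by (auto simp: S_def)
    with before[of a] \<open>j \<noteq> k\<close> show False by (cases a) auto
  qed
  moreover have "\<pi> ` S = S \<or> (transpose k j \<circ> \<pi>) ` S = S"
  proof -
    define \<tau> where "\<tau> = (if (\<pi> ^^ m) k = k then \<pi> else transpose k j \<circ> \<pi>)"
    have "\<tau> ((\<pi> ^^ a) k) \<in> S" if "a < m" for a
    proof (cases "Suc a = m")
      case True
      then show ?thesis using m \<open>k \<in> S\<close> by (auto simp: \<tau>_def transpose_def)
    next
      case False
      with that have "Suc a < m" by simp
      then have "(\<pi> ^^ Suc a) k \<in> S" unfolding S_def by (intro imageI) simp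
      moreover have "(\<pi> ^^ Suc a) k \<notin> {j, k}" using before \<open>Suc a < m\<close> by blast
      ultimately show ?thesis by (auto simp: \<tau>_def transpose_def)
    qed
    then have "\<tau> ` S \<subseteq> S" by (auto simp: S_def)
    moreover have "inj_on \<tau> S"
    proof (cases "(\<pi> ^^ m) k = k")
      case True
      then show ?thesis
        using permutes_inj_on[OF pi] by (simp add: \<tau>_def)
    next
      case False
      then show ?thesis
        unfolding \<tau>_def by (simp add: comp_inj_on permutes_inj_on[OF pi] inj_on_subset[OF inj_transpose])
    qed
    ultimately have "\<tau> ` S = S"
      using \<open>finite S\<close> by (metis endo_inj_surj)
    then show ?thesis by (auto simp: \<tau>_def split: if_splits)
  qed
  ultimately show ?thesis using that by blast
qed

lemma permutes_glue:
  assumes \<sigma>: "\<sigma> permutes U" and \<tau>: "\<tau> permutes U" and "S \<subseteq> U" and eq: "\<sigma> ` S = \<tau> ` S"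
  shows "(\<lambda>l. if l \<in> S then \<sigma> l else \<tau> l) permutes U"
proof (rule bij_imp_permutes)
  have "bij_betw \<sigma> S (\<tau> ` S)"
    using permutes_inj_on[OF \<sigma>, of S] eq by (simp add: bij_betw_def)
  moreover have "bij_betw \<tau> (U - S) (U - \<tau> ` S)"
    using \<tau> \<open>S \<subseteq> U\<close> by (simp add: bij_betw_def permutes_inj_on image_set_diff permutes_image permutes_inj)
  ultimately have "bij_betw (\<lambda>l. if l \<in> S then \<sigma> l else \<tau> l) (S \<union> (U - S)) (\<tau> ` S \<union> (U - \<tau> ` S))"
    by (intro bij_betw_disjoint_Un) auto
  moreover have "S \<union> (U - S) = U" "\<tau> ` S \<union> (U - \<tau> ` S) = U"
    using \<open>S \<subseteq> U\<close> permutes_image[OF \<tau>] by auto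
  ultimately show "bij_betw (\<lambda>l. if l \<in> S then \<sigma> l else \<tau> l) U U" by simp
qed (use \<tau> \<open>S \<subseteq> U\<close> in \<open>auto simp: permutes_def\<close>)

section \<open>Permanents, minors and the adjoint\<close>

lemma sdet_carrier:
  "A \<in> carrier_mat n n \<Longrightarrow> sdet A = (\<Sum>p | p permutes {0..<n}. \<Prod>i = 0..<n. A $$ (i, p i))"
  by (simp add: sdet_def)

text \<open>
  The permutations of the remaining indices correspond to the permutations of all indices that
  send \<open>j\<close> to \<open>k\<close>, with the factor of row \<open>j\<close> left out.
\<close>
lemma sdet_mat_delete:
  assumes A: "A \<in> carrier_mat n n" and j: "j < n" and k: "k < n"
  shows "sdet (mat_delete A j k) =
    (\<Sum>p | p permutes {0..<n} \<and> p j = k. \<Prod>l\<in>{0..<n} - {j}. A $$ (l, p l))"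
proof -
  obtain m where n: "n = Suc m" using j by (cases n) auto
  let ?ins = "permutation_insert j k"
  have minor: "mat_delete A j k \<in> carrier_mat m m"
    using mat_delete_carrier[OF A] n by simp
  have minor_term: "(\<Prod>l\<in>{0..<n} - {j}. A $$ (l, ?ins q l)) = (\<Prod>l = 0..<m. mat_delete A j k $$ (l, q l))"
    if q: "q permutes {0..<m}" for q
  proof -
    have "(\<Prod>l\<in>{0..<n} - {j}. A $$ (l, ?ins q l))
        = (\<Prod>l\<in>insert_index j ` {0..<m}. A $$ (l, ?ins q l))"
      using insert_index_image[of j m] j n by simp
    also have "\<dots> = (\<Prod>l = 0..<m. A $$ (insert_index j l, ?ins q (insert_index j l)))"
      by (simp add: prod.reindex[OF insert_index_inj_on])
    also have "\<dots> = (\<Prod>l = 0..<m. mat_delete A j k $$ (l, q l))"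
    proof (rule prod.cong[OF refl])
      fix l assume l: "l \<in> {0..<m}"
      then have "q l < m" using permutes_in_image[OF q, of l] by simp
      moreover have "?ins q (insert_index j l) = insert_index k (q l)"
        by (auto simp: permutation_insert_expand insert_index_def)
      ultimately show "A $$ (insert_index j l, ?ins q (insert_index j l)) = mat_delete A j k $$ (l, q l)"
        using mat_delete_index[of A m j k l "q l"] A j k n l by simp
    qed
    finally show ?thesis .
  qed
  have "{p. p permutes {0..<n} \<and> p j = k} = ?ins ` {q. q permutes {0..<m}}"
    using permutation_fix[of j m k] j k n by simp
  then have "(\<Sum>p | p permutes {0..<n} \<and> p j = k. \<Prod>l\<in>{0..<n} - {j}. A $$ (l, p l))
      = (\<Sum>q | q permutes {0..<m}. \<Prod>l\<in>{0..<n} - {j}. A $$ (l, ?ins q l))"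
    using permutation_insert_inj_on[of j m k] j k n by (simp add: sum.reindex)
  also have "\<dots> = sdet (mat_delete A j k)"
    using minor_term by (simp add: sdet_carrier[OF minor])
  finally show ?thesis by simp
qed

lemma sdet_transpose:
  assumes A: "A \<in> carrier_mat n n"
  shows "sdet (transpose_mat A) = sdet A"
proof -
  let ?inv = "Hilbert_Choice.inv"
  let ?P = "{p. p permutes {0..<n}}"
  have "(\<Prod>i = 0..<n. A $$ (i, p i)) = (\<Prod>i = 0..<n. transpose_mat A $$ (i, ?inv p i))"
    if p: "p permutes {0..<n}" for p
  proof -
    have "(\<Prod>i = 0..<n. transpose_mat A $$ (i, ?inv p i))
        = (\<Prod>i = 0..<n. transpose_mat A $$ (p i, ?inv p (p i)))"
      using prod.permute[OF p, of "\<lambda>i. transpose_mat A $$ (i, ?inv p i)"] by (simp add: o_def)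
    also have "\<dots> = (\<Prod>i = 0..<n. A $$ (i, p i))"
    proof (rule prod.cong[OF refl])
      fix i assume "i \<in> {0..<n}"
      moreover from this have "p i < n" using permutes_in_image[OF p, of i] by simp
      ultimately show "transpose_mat A $$ (p i, ?inv p (p i)) = A $$ (i, p i)"
        using A by (simp add: permutes_inverses[OF p])
    qed
    finally show ?thesis by simp
  qed
  then have "sdet A = (\<Sum>p\<in>?P. \<Prod>i = 0..<n. transpose_mat A $$ (i, ?inv p i))"
    by (simp add: sdet_carrier[OF A])
  also have "\<dots> = (\<Sum>p\<in>?P. \<Prod>i = 0..<n. transpose_mat A $$ (i, p i))"
    by (rule sum_permutations_inverse[symmetric])
  also have "\<dots> = sdet (transpose_mat A)"
    by (rule sdet_carrier[symmetric]) (use A in simp)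
  finally show ?thesis by simp
qed

lemma sadj_carrier: "A \<in> carrier_mat n n \<Longrightarrow> sadj A \<in> carrier_mat n n"
  by (simp add: sadj_def)

lemma sadj_transpose:
  assumes A: "A \<in> carrier_mat n n"
  shows "sadj (transpose_mat A) = transpose_mat (sadj A)"
proof (rule eq_matI)
  fix i j assume "i < dim_row (transpose_mat (sadj A))" "j < dim_col (transpose_mat (sadj A))"
  then have ij: "i < n" "j < n" using A by (auto simp: sadj_def)
  have "mat_delete (transpose_mat A) j i = transpose_mat (mat_delete A i j)"
    using A ij by (auto simp: mat_delete_def)
  then show "sadj (transpose_mat A) $$ (i, j) = transpose_mat (sadj A) $$ (i, j)"
    using A ij sdet_transpose[OF mat_delete_carrier[OF A]] by (simp add: sadj_def)
qed (use A in \<open>auto simp: sadj_def\<close>)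

text \<open>
  The weight of the permutation \<open>p\<close> in the matrix whose row \<open>l\<close> is row \<open>f l\<close> of \<open>A\<close>. Overwriting row
  \<open>j\<close> by row \<open>i\<close> is the case \<open>f = id(j := i)\<close>.
\<close>
definition row_weight :: "'a::comm_semiring_1 mat \<Rightarrow> (nat \<Rightarrow> nat) \<Rightarrow> (nat \<Rightarrow> nat) \<Rightarrow> 'a" where
  "row_weight A f p = (\<Prod>l = 0..<dim_row A. A $$ (f l, p l))"

lemma sdet_row_weight:
  "A \<in> carrier_mat n n \<Longrightarrow> sdet A = (\<Sum>p | p permutes {0..<n}. row_weight A id p)"
  by (simp add: sdet_carrier row_weight_def)

lemma row_weight_permute:
  "t permutes {0..<dim_row A} \<Longrightarrow> row_weight A (f \<circ> t) (p \<circ> t) = row_weight A f p"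
  unfolding row_weight_def
  using prod.permute[of t "{0..<dim_row A}" "\<lambda>l. A $$ (f l, p l)"] by (simp add: o_def)

lemma row_weight_swap_equal_rows:
  assumes "i < dim_row A" "j < dim_row A"
  shows "row_weight A (id(j := i)) (p \<circ> transpose i j) = row_weight A (id(j := i)) p"
proof -
  have "id(j := i) \<circ> transpose i j = id(j := i)" by (auto simp: fun_eq_iff transpose_def)
  moreover have "transpose i j permutes {0..<dim_row A}"
    using assms by (intro permutes_swap_id) auto
  ultimately show ?thesis using row_weight_permute by metis
qed

text \<open>
  The column \<open>k\<close> that the minor leaves free in row \<open>j\<close> is filled by the entry of row \<open>i\<close>. The sum over
  all \<open>k\<close> is the expansion along row \<open>j\<close> of the permanent of \<open>A\<close> with row \<open>j\<close> overwritten by row \<open>i\<close>.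
\<close>
lemma mult_sadj_summand:
  assumes A: "A \<in> carrier_mat n n" and "i < n" "j < n" "k < n"
  shows "A $$ (i, k) * sadj A $$ (k, j) =
    (\<Sum>p | p permutes {0..<n} \<and> p j = k. row_weight A (id(j := i)) p)"
proof -
  have "A $$ (i, k) * (\<Prod>l\<in>{0..<n} - {j}. A $$ (l, p l)) = row_weight A (id(j := i)) p"
    if "p j = k" for p
  proof -
    have "row_weight A (id(j := i)) p
        = A $$ (i, k) * (\<Prod>l\<in>{0..<n} - {j}. A $$ ((id(j := i)) l, p l))"
      using A \<open>j < n\<close> that by (simp add: row_weight_def prod.remove[of _ j])
    also have "(\<Prod>l\<in>{0..<n} - {j}. A $$ ((id(j := i)) l, p l)) = (\<Prod>l\<in>{0..<n} - {j}. A $$ (l, p l))"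
      by (intro prod.cong) auto
    finally show ?thesis by (rule sym)
  qed
  then show ?thesis
    using assms by (simp add: sadj_def sdet_mat_delete sum_distrib_left)
qed

lemma mult_mat_entry:
  "\<lbrakk>A \<in> carrier_mat n n; B \<in> carrier_mat n n; i < n; j < n\<rbrakk> \<Longrightarrow>
    (A * B) $$ (i, j) = (\<Sum>k = 0..<n. A $$ (i, k) * B $$ (k, j))"
  by (auto simp: scalar_prod_def intro!: sum.cong)

lemma mult_sadj_entry:
  assumes A: "A \<in> carrier_mat n n" and ij: "i < n" "j < n"
  shows "(A * sadj A) $$ (i, j) = (\<Sum>p | p permutes {0..<n}. row_weight A (id(j := i)) p)"
proof -
  let ?P = "{p. p permutes {0..<n}}"
  have "(A * sadj A) $$ (i, j) = (\<Sum>k = 0..<n. A $$ (i, k) * sadj A $$ (k, j))"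
    by (rule mult_mat_entry[OF A sadj_carrier[OF A] ij])
  also have "\<dots> = (\<Sum>k = 0..<n. \<Sum>p\<in>{p \<in> ?P. p j = k}. row_weight A (id(j := i)) p)"
    using mult_sadj_summand[OF A ij] by (intro sum.cong) auto
  also have "\<dots> = (\<Sum>p\<in>?P. row_weight A (id(j := i)) p)"
    using permutes_in_image[of _ "{0..<n}" j] ij
    by (intro sum.group) (auto simp: finite_permutations)
  finally show ?thesis .
qed

lemma mult_sadj_diag:
  "A \<in> carrier_mat n n \<Longrightarrow> i < n \<Longrightarrow> (A * sadj A) $$ (i, i) = sdet A"
  using mult_sadj_entry[of A n i i] sdet_row_weight[of A n] fun_upd_triv[of id i] by simp

text \<open>
  Together the two factors on the left use every column twice and every row twice, except that
  \<open>j\<close> is used once less and \<open>i\<close> once more. Let \<open>\<sigma>\<close> and \<open>\<tau>\<close> trade their columns outside a set \<open>S\<close>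
  of positions that contains \<open>k\<close> but not \<open>j\<close> and on which both use the same columns. Then both
  defects, \<open>i\<close> in position \<open>k\<close> and \<open>k\<close> in position \<open>j\<close>, end up in the same factor, where they
  combine, after renaming positions, to \<open>i\<close> in position \<open>j\<close>. Such a set exists after possibly
  exchanging the columns of the positions \<open>j\<close> and \<open>k\<close> in \<open>\<tau>\<close>, which both carry row \<open>k\<close>.
\<close>
lemma row_weight_exchange:
  assumes A: "A \<in> carrier_mat n n" and \<sigma>: "\<sigma> permutes {0..<n}" and \<tau>: "\<tau> permutes {0..<n}"
    and "j < n" "k < n" "j \<noteq> k"
  obtains \<sigma>' \<tau>' where "\<sigma>' permutes {0..<n}" "\<tau>' permutes {0..<n}" "\<sigma>' \<noteq> \<tau>'"
    "row_weight A (id(k := i)) \<sigma> * row_weight A (id(j := k)) \<tau> =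
     row_weight A (id(j := i)) \<sigma>' * row_weight A id \<tau>'"
proof -
  let ?U = "{0..<n}"
  let ?inv = "Hilbert_Choice.inv"
  let ?t = "transpose k j"
  have t: "?t permutes ?U" using assms by (intro permutes_swap_id) auto
  have "?inv \<tau> \<circ> \<sigma> permutes ?U"
    by (rule permutes_compose[OF \<sigma> permutes_inv[OF \<tau>]])
  then obtain S where S: "S \<subseteq> ?U" "k \<in> S" "j \<notin> S"
    "(?inv \<tau> \<circ> \<sigma>) ` S = S \<or> (?t \<circ> (?inv \<tau> \<circ> \<sigma>)) ` S = S"
    using permutes_separating_set[of "?inv \<tau> \<circ> \<sigma>" ?U k j] assms by auto
  define \<tau>1 where "\<tau>1 = (if (?inv \<tau> \<circ> \<sigma>) ` S = S then \<tau> else \<tau> \<circ> ?t)"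
  have \<tau>1: "\<tau>1 permutes ?U"
    unfolding \<tau>1_def using \<tau> permutes_compose[OF t \<tau>] by simp
  have w1: "row_weight A (id(j := k)) \<tau>1 = row_weight A (id(j := k)) \<tau>"
    unfolding \<tau>1_def using row_weight_swap_equal_rows[of k A j \<tau>] assms by auto
  have image: "\<sigma> ` S = \<tau>1 ` S"
  proof (cases "(?inv \<tau> \<circ> \<sigma>) ` S = S")
    case True
    then have "\<tau> ` S = (\<tau> \<circ> (?inv \<tau> \<circ> \<sigma>)) ` S" by (metis image_comp)
    also have "\<tau> \<circ> (?inv \<tau> \<circ> \<sigma>) = \<sigma>"
      by (simp add: fun_eq_iff permutes_inverses[OF \<tau>])
    finally show ?thesis using True by (simp add: \<tau>1_def)
  next
    case False
    with S have "(\<tau> \<circ> ?t) ` S = ((\<tau> \<circ> ?t) \<circ> (?t \<circ> (?inv \<tau> \<circ> \<sigma>))) ` S" by (metis image_comp)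
    also have "(\<tau> \<circ> ?t) \<circ> (?t \<circ> (?inv \<tau> \<circ> \<sigma>)) = \<sigma>"
      by (simp add: fun_eq_iff permutes_inverses[OF \<tau>])
    finally show ?thesis using False by (simp add: \<tau>1_def)
  qed
  define \<rho> where "\<rho> = (\<lambda>l. if l \<in> S then \<sigma> l else \<tau>1 l)"
  define \<tau>' where "\<tau>' = (\<lambda>l. if l \<in> S then \<tau>1 l else \<sigma> l)"
  \<comment> \<open>The rows that go with \<open>\<rho>\<close>: both defects are collected here, and \<open>\<tau>'\<close> is left with none.\<close>
  define g where "g = (id(k := i))(j := k)"
  have \<rho>: "\<rho> permutes ?U" unfolding \<rho>_def using \<sigma> \<tau>1 S image by (intro permutes_glue)
  have \<tau>': "\<tau>' permutes ?U" unfolding \<tau>'_def using \<sigma> \<tau>1 S image by (intro permutes_glue) auto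
  have "row_weight A (id(k := i)) \<sigma> * row_weight A (id(j := k)) \<tau>
      = (\<Prod>l = 0..<n. A $$ ((id(k := i)) l, \<sigma> l) * A $$ ((id(j := k)) l, \<tau>1 l))"
    unfolding w1[symmetric] using A by (simp add: row_weight_def prod.distrib)
  also have "\<dots> = (\<Prod>l = 0..<n. A $$ (g l, \<rho> l) * A $$ (id l, \<tau>' l))"
    using S \<open>j \<noteq> k\<close> by (intro prod.cong) (auto simp: g_def \<rho>_def \<tau>'_def mult.commute)
  also have "\<dots> = row_weight A g \<rho> * row_weight A id \<tau>'"
    using A by (simp add: row_weight_def prod.distrib)
  also have "row_weight A g \<rho> = row_weight A (g \<circ> ?t) (\<rho> \<circ> ?t)"
    using row_weight_permute[of ?t A g \<rho>] t A by simp
  also have "g \<circ> ?t = id(j := i)"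
    using \<open>j \<noteq> k\<close> by (auto simp: g_def fun_eq_iff transpose_def)
  finally have "row_weight A (id(k := i)) \<sigma> * row_weight A (id(j := k)) \<tau> =
     row_weight A (id(j := i)) (\<rho> \<circ> ?t) * row_weight A id \<tau>'" .
  \<comment> \<open>At position \<open>j\<close> the two new permutations take the columns \<open>\<sigma> k\<close> and \<open>\<sigma> j\<close>.\<close>
  moreover have "\<rho> \<circ> ?t \<noteq> \<tau>'"
  proof
    assume "\<rho> \<circ> ?t = \<tau>'"
    then have "(\<rho> \<circ> ?t) j = \<tau>' j" by simp
    then have "\<sigma> k = \<sigma> j" using S by (simp add: \<rho>_def \<tau>'_def)
    then show False using permutes_inj[OF \<sigma>] \<open>j \<noteq> k\<close> by (auto dest: injD)
  qed
  ultimately show ?thesis using that permutes_compose[OF t \<rho>] \<tau>' by blast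
qed

section \<open>The product of a matrix with its adjoint\<close>

context supertropical_domain
begin

text \<open>
  At most one of the two permutations is the dominating one. Invertibility of the determinant is
  needed to keep the inequality strict after multiplication, since in a general supertropical
  domain multiplication is only weakly monotone.
\<close>
lemma distinct_perms_nu_less:
  assumes A: "A \<in> carrier_mat n n" and unit: "sdet A dvd 1"
    and "\<sigma> permutes {0..<n}" "\<tau> permutes {0..<n}" "\<sigma> \<noteq> \<tau>"
  shows "row_weight A id \<sigma> * row_weight A id \<tau> \<prec> sdet A * sdet A"
proof -
  let ?P = "{p. p permutes {0..<n}}"
  have fin: "finite ?P" by (simp add: finite_permutations)
  have "(\<Sum>p\<in>?P. row_weight A id p) \<notin> G0"
    using unit_not_ghost[OF unit] by (simp add: sdet_row_weight[OF A])
  with fin obtain \<pi> where less: "\<And>p. p permutes {0..<n} \<Longrightarrow> p \<noteq> \<pi> \<Longrightarrow> row_weight A id p \<prec> sdet A"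
    unfolding sdet_row_weight[OF A] by (rule tangible_sum_dominant) auto
  have le: "row_weight A id p \<preceq> sdet A" if "p permutes {0..<n}" for p
    unfolding sdet_row_weight[OF A] using fin that by (intro member_nu_le_sum) auto
  have *: "row_weight A id p * row_weight A id q \<prec> sdet A * sdet A"
    if "p permutes {0..<n}" "q permutes {0..<n}" "q \<noteq> \<pi>" for p q
  proof -
    have "row_weight A id p * row_weight A id q \<preceq> sdet A * row_weight A id q"
      using le[OF that(1)] by (rule nu_le_mult_right)
    also have "sdet A * row_weight A id q \<prec> sdet A * sdet A"
      using unit less[OF that(2,3)] by (rule nu_less_mult_unit)
    finally show ?thesis .
  qed
  show ?thesis
  proof (cases "\<tau> = \<pi>")
    case True
    then show ?thesis using *[of \<tau> \<sigma>] assms by (simp add: mult.commute)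
  qed (use * assms in auto)
qed

text \<open>
  By the exchange, every product of two terms on the left is bounded by a term of the determinant
  times a term of the entry on the right. For \<open>j = k\<close>, where the exchange has nothing to separate,
  \<open>N\<^sub>j\<^sub>j\<close> is the determinant and the two sides are equal.
\<close>
lemma mult_sadj_triangle:
  assumes A: "A \<in> carrier_mat n n" and ijk: "i < n" "j < n" "k < n"
  defines "N \<equiv> A * sadj A"
  shows "N $$ (i, k) * N $$ (k, j) \<preceq> sdet A * N $$ (i, j)"
proof (cases "j = k")
  case True
  then show ?thesis using mult_sadj_diag[OF A] ijk by (simp add: N_def mult.commute)
next
  case False
  let ?P = "{p. p permutes {0..<n}}"
  have "row_weight A (id(k := i)) \<sigma> * row_weight A (id(j := k)) \<tau> \<preceq> sdet A * N $$ (i, j)"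
    if "\<sigma> \<in> ?P" "\<tau> \<in> ?P" for \<sigma> \<tau>
  proof -
    from that False ijk obtain \<sigma>' \<tau>' where *: "\<sigma>' \<in> ?P" "\<tau>' \<in> ?P"
      "row_weight A (id(k := i)) \<sigma> * row_weight A (id(j := k)) \<tau> =
       row_weight A (id(j := i)) \<sigma>' * row_weight A id \<tau>'"
      using row_weight_exchange[OF A, of \<sigma> \<tau> j k i] by (metis mem_Collect_eq)
    have "row_weight A (id(j := i)) \<sigma>' \<preceq> N $$ (i, j)" "row_weight A id \<tau>' \<preceq> sdet A"
      unfolding N_def mult_sadj_entry[OF A ijk(1,2)] sdet_row_weight[OF A]
      using * by (auto intro!: member_nu_le_sum simp: finite_permutations)
    then show ?thesis unfolding *(3) by (simp add: nu_le_mult mult.commute[of "sdet A"])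
  qed
  then show ?thesis
    unfolding N_def mult_sadj_entry[OF A ijk(1,3)] mult_sadj_entry[OF A ijk(3,2)] sum_product
    by (intro sum_nu_le) auto
qed

text \<open>
  For \<open>i = j\<close> the exchange turns each product of terms into a product of two weights of different
  permutations for the determinant itself.
\<close>
lemma mult_sadj_two_cycle:
  assumes A: "A \<in> carrier_mat n n" and unit: "sdet A dvd 1" and ik: "i < n" "k < n" "i \<noteq> k"
  defines "N \<equiv> A * sadj A"
  shows "N $$ (i, k) * N $$ (k, i) \<prec> sdet A * sdet A"
proof -
  let ?P = "{p. p permutes {0..<n}}"
  have "row_weight A (id(k := i)) \<sigma> * row_weight A (id(i := k)) \<tau> \<prec> sdet A * sdet A"
    if "\<sigma> \<in> ?P" "\<tau> \<in> ?P" for \<sigma> \<tau>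
  proof -
    from that ik obtain \<sigma>' \<tau>' where *: "\<sigma>' permutes {0..<n}" "\<tau>' permutes {0..<n}" "\<sigma>' \<noteq> \<tau>'"
      "row_weight A (id(k := i)) \<sigma> * row_weight A (id(i := k)) \<tau> =
       row_weight A id \<sigma>' * row_weight A id \<tau>'"
      using row_weight_exchange[OF A, of \<sigma> \<tau> i k i] fun_upd_triv[of id i] by auto
    show ?thesis unfolding *(4) using A unit *(1-3) by (rule distinct_perms_nu_less)
  qed
  moreover have "?P \<noteq> {}" using permutes_id by blast
  ultimately show ?thesis
    unfolding N_def mult_sadj_entry[OF A ik(1,2)] mult_sadj_entry[OF A ik(2,1)] sum_product
    by (intro sum_nu_less) (simp_all add: finite_permutations)
qed

text \<open>
  The largest term in the \<open>k\<close>-th summand belongs to a permutation \<open>p\<close> with \<open>p j = k\<close>. As the rows in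
  positions \<open>i\<close> and \<open>j\<close> agree, composing \<open>p\<close> with the transposition of \<open>i\<close> and \<open>j\<close> gives a
  term of the same weight, which occurs in the summand of index \<open>p i \<noteq> k\<close>.
\<close>
lemma mult_sadj_tied:
  assumes A: "A \<in> carrier_mat n n" and ij: "i < n" "j < n" "i \<noteq> j" and k: "k < n"
  obtains l where "l < n" "l \<noteq> k"
    "A $$ (i, k) * sadj A $$ (k, j) \<preceq> A $$ (i, l) * sadj A $$ (l, j)"
proof -
  let ?P = "\<lambda>k. {p. p permutes {0..<n} \<and> p j = k}"
  let ?w = "row_weight A (id(j := i))"
  have fin: "finite (?P k)" for k
    by (rule finite_subset[OF _ finite_permutations[of "{0..<n}"]]) auto
  have "transpose j k \<in> ?P k" using ij k by (simp add: permutes_swap_id)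
  then have "?P k \<noteq> {}" by blast
  with fin obtain p where p: "p \<in> ?P k" and max: "\<And>q. q \<in> ?P k \<Longrightarrow> ?w q \<preceq> ?w p"
    by (rule ex_nu_max[where f = ?w]) blast
  define q where "q = p \<circ> transpose i j"
  have q: "q permutes {0..<n}"
    unfolding q_def using p ij by (intro permutes_compose) (auto intro: permutes_swap_id)
  then have l: "q j < n" using permutes_in_image[of q "{0..<n}" j] ij by simp
  have "q j = p i" by (simp add: q_def)
  then have "q j \<noteq> k" using p ij permutes_inj[of p] by (auto dest: injD)
  have "A $$ (i, k) * sadj A $$ (k, j) \<preceq> ?w p"
    unfolding mult_sadj_summand[OF A ij(1,2) k] using max by (intro sum_nu_le) auto
  also have "?w p = ?w q"
    unfolding q_def using row_weight_swap_equal_rows[of i A j p] A ij by simp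
  also have "?w q \<preceq> A $$ (i, q j) * sadj A $$ (q j, j)"
    unfolding mult_sadj_summand[OF A ij(1,2) l] using fin q by (intro member_nu_le_sum) auto
  finally show ?thesis using that l \<open>q j \<noteq> k\<close> by blast
qed

text \<open>
  Since the tie between summands only concerns ghost images, it suffices that \<open>B\<close> agrees with
  the adjoint up to ghost images. This covers the adjoint and the tangible adjoint at once.
\<close>
lemma mult_sadj_offdiag_ghost:
  assumes A: "A \<in> carrier_mat n n" and ij: "i < n" "j < n" "i \<noteq> j"
    and B: "B \<in> carrier_mat n n"
    and nu: "\<And>k. k < n \<Longrightarrow> ghost_map (B $$ (k, j)) = ghost_map (sadj A $$ (k, j))"
  shows "(A * B) $$ (i, j) \<in> G0"
  unfolding mult_mat_entry[OF A B ij(1,2)]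
proof (rule sum_ghost_if_no_dominant)
  fix k assume "k \<in> {0..<n}"
  then have k: "k < n" by simp
  obtain l where l: "l < n" "l \<noteq> k"
    and le: "A $$ (i, k) * sadj A $$ (k, j) \<preceq> A $$ (i, l) * sadj A $$ (l, j)"
    using mult_sadj_tied[OF A ij k] .
  have "A $$ (i, k) * B $$ (k, j) \<preceq> A $$ (i, l) * B $$ (l, j)"
    using le nu k l by (simp add: nu_le_def ghost_map_mult)
  with l show "\<exists>l\<in>{0..<n}. l \<noteq> k \<and> A $$ (i, k) * B $$ (k, j) \<preceq> A $$ (i, l) * B $$ (l, j)"
    by auto
qed simp

lemma ghost_map_retract:
  assumes "tangible_retract G0 hat"
  shows "ghost_map (hat a) = ghost_map a"
proof (cases "a \<in> G0")
  case True
  with assms show ?thesis by (simp add: tangible_retract_def ghost_map_of_ghost)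
next
  case False
  with assms show ?thesis by (simp add: tangible_retract_def tangibles_def)
qed

text \<open>
  Termwise the two products have equal ghost images. Off the diagonal both entries are ghosts, and
  a ghost is determined by its image. On the diagonal the entry is the tangible determinant, hence
  equal to one dominating summand; a tangible product has tangible factors, so the retract fixes
  the minor in that summand.
\<close>
lemma mult_tangible_sadj:
  assumes A: "A \<in> carrier_mat n n" and unit: "sdet A dvd 1" and hat: "tangible_retract G0 hat"
  shows "A * tangible_sadj hat A = A * sadj A"
proof (rule eq_matI)
  have S: "sadj A \<in> carrier_mat n n" and T: "tangible_sadj hat A \<in> carrier_mat n n"
    using sadj_carrier[OF A] by (auto simp: tangible_sadj_def)
  have T_entry: "tangible_sadj hat A $$ (k, j) = hat (sadj A $$ (k, j))" if "k < n" "j < n" for k j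
    using S that by (simp add: tangible_sadj_def)
  have nu: "ghost_map (tangible_sadj hat A $$ (k, j)) = ghost_map (sadj A $$ (k, j))"
    if "k < n" "j < n" for k j
    using that by (simp add: T_entry ghost_map_retract[OF hat])
  fix i j assume "i < dim_row (A * sadj A)" "j < dim_col (A * sadj A)"
  then have ij: "i < n" "j < n" using A S by auto
  show "(A * tangible_sadj hat A) $$ (i, j) = (A * sadj A) $$ (i, j)"
  proof (cases "i = j")
    case False
    have "(A * tangible_sadj hat A) $$ (i, j) \<in> G0" "(A * sadj A) $$ (i, j) \<in> G0"
      using mult_sadj_offdiag_ghost[OF A ij False] S T nu ij by auto
    moreover have "ghost_map ((A * tangible_sadj hat A) $$ (i, j)) = ghost_map ((A * sadj A) $$ (i, j))"
      using ij nu by (simp add: mult_mat_entry[OF A T] mult_mat_entry[OF A S] ghost_map_sum ghost_map_mult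
          del: index_mult_mat)
    ultimately show ?thesis by (metis ghost_map_of_ghost)
  next
    case True
    let ?f = "\<lambda>k. A $$ (i, k) * sadj A $$ (k, i)"
    let ?g = "\<lambda>k. A $$ (i, k) * tangible_sadj hat A $$ (k, i)"
    have "sum ?f {0..<n} = sdet A"
      using mult_sadj_diag[OF A ij(1)] mult_mat_entry[OF A S ij(1) ij(1)] by simp
    then have "sum ?f {0..<n} \<notin> G0" using unit_not_ghost[OF unit] by simp
    then obtain k where k: "k \<in> {0..<n}" "sum ?f {0..<n} = ?f k"
      and less: "\<And>l. l \<in> {0..<n} \<Longrightarrow> l \<noteq> k \<Longrightarrow> ?f l \<prec> ?f k"
      by (rule tangible_sum_dominant[rotated]) auto
    have "?f k \<notin> G0" using k(2) \<open>sum ?f {0..<n} \<notin> G0\<close> by simp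
    then have "sadj A $$ (k, i) \<notin> G0" using ghost_mult_left by blast
    then have "tangible_sadj hat A $$ (k, i) = sadj A $$ (k, i)"
      using hat k ij by (simp add: T_entry tangible_retract_def tangibles_def)
    have "sum ?g {0..<n} = ?g k"
    proof (rule sum_eq_dominant)
      fix l assume "l \<in> {0..<n}" "l \<noteq> k"
      with less[of l] k ij show "?g l \<prec> ?g k"
        by (simp add: nu_less_def nu_le_def ghost_map_mult nu)
    qed (use k in auto)
    also have "\<dots> = sum ?f {0..<n}"
      using k(2) \<open>tangible_sadj hat A $$ (k, i) = sadj A $$ (k, i)\<close> by simp
    finally show ?thesis
      using True mult_mat_entry[OF A T ij] mult_mat_entry[OF A S ij] by simp
  qed
qed (use A in \<open>auto simp: tangible_sadj_def\<close>)

end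

section \<open>Recognizing quasi-identity matrices\<close>

context supertropical_domain
begin

text \<open>
  Take a point \<open>l\<close> moved by \<open>p\<close>, with predecessor \<open>q\<close> and successor \<open>s\<close>, and bypass it: let \<open>q\<close> go
  directly to \<open>s\<close> and fix \<open>l\<close>. By the triangle inequality this does not decrease the product, and
  fewer points are moved. If \<open>q = s\<close>, then a 2-cycle is removed instead, whose weight is
  strictly below \<open>1\<close> while the remaining factors are at most \<open>1\<close>.
\<close>
lemma perm_prod_nu_less_one:
  fixes m :: "'i \<Rightarrow> 'i \<Rightarrow> 'a"
  assumes "finite U"
    and diag: "\<And>i. i \<in> U \<Longrightarrow> m i i = 1"
    and triangle: "\<And>i j k. \<lbrakk>i \<in> U; j \<in> U; k \<in> U\<rbrakk> \<Longrightarrow> m i k * m k j \<preceq> m i j"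
    and two_cycle: "\<And>i k. \<lbrakk>i \<in> U; k \<in> U; i \<noteq> k\<rbrakk> \<Longrightarrow> m i k * m k i \<prec> 1"
    and "p permutes U" "p \<noteq> id"
  shows "(\<Prod>i\<in>U. m i (p i)) \<prec> 1"
  using assms(5,6)
proof (induction "card {x \<in> U. p x \<noteq> x}" arbitrary: p rule: less_induct)
  case less
  note p = less.prems(1)
  obtain l where "p l \<noteq> l" using less.prems(2) by (auto simp: fun_eq_iff)
  then have l: "l \<in> U" using p by (auto simp: permutes_def)
  define s where "s = p l"
  have s: "s \<in> U" "s \<noteq> l" using l \<open>p l \<noteq> l\<close> permutes_in_image[OF p] by (auto simp: s_def)
  obtain q where q: "p q = l" using permutes_surj[OF p] by (metis surjD)
  then have "q \<in> U" "q \<noteq> l" using l \<open>p l \<noteq> l\<close> permutes_in_image[OF p, of q] by auto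
  define p' where "p' = transpose l s \<circ> p"
  have p': "p' permutes U"
    unfolding p'_def using p l s by (intro permutes_compose) (auto intro: permutes_swap_id)
  have p'_l: "p' l = l" and p'_q: "p' q = s" by (simp_all add: p'_def s_def[symmetric] q)
  have p'_x: "p' x = p x" if "x \<noteq> l" "x \<noteq> q" for x
  proof -
    have "p x \<noteq> l" "p x \<noteq> s" using that q permutes_inj[OF p] by (auto simp: s_def dest: injD)
    then show ?thesis by (simp add: p'_def transpose_def)
  qed
  let ?R = "\<Prod>x\<in>U - {l} - {q}. m x (p x)"
  have prod_p: "(\<Prod>x\<in>U. m x (p x)) = (m q l * m l s) * ?R"
    using \<open>finite U\<close> l \<open>q \<in> U\<close> \<open>q \<noteq> l\<close> q
    by (simp add: prod.remove[of U l] prod.remove[of "U - {l}" q] s_def ac_simps)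
  have "(\<Prod>x\<in>U. m x (p' x)) = m q s * (\<Prod>x\<in>U - {l} - {q}. m x (p' x))"
    using \<open>finite U\<close> l \<open>q \<in> U\<close> \<open>q \<noteq> l\<close> p'_l p'_q
    by (simp add: prod.remove[of U l] prod.remove[of "U - {l}" q] diag)
  also have "(\<Prod>x\<in>U - {l} - {q}. m x (p' x)) = ?R"
    using p'_x by (intro prod.cong) auto
  finally have prod_p': "(\<Prod>x\<in>U. m x (p' x)) = m q s * ?R" .
  have IH: "(\<Prod>x\<in>U. m x (p' x)) \<prec> 1" if "p' \<noteq> id"
  proof (rule less.hyps)
    have "{x \<in> U. p' x \<noteq> x} \<subset> {x \<in> U. p x \<noteq> x}"
    proof
      show "{x \<in> U. p' x \<noteq> x} \<subseteq> {x \<in> U. p x \<noteq> x}"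
      proof
        fix x assume "x \<in> {x \<in> U. p' x \<noteq> x}"
        then have "x \<in> U" "x \<noteq> l" "p' x \<noteq> x" using p'_l by auto
        then show "x \<in> {x \<in> U. p x \<noteq> x}"
          using p'_x[of x] q by (cases "x = q") auto
      qed
      show "{x \<in> U. p' x \<noteq> x} \<noteq> {x \<in> U. p x \<noteq> x}"
        using l \<open>p l \<noteq> l\<close> p'_l by blast
    qed
    then show "card {x \<in> U. p' x \<noteq> x} < card {x \<in> U. p x \<noteq> x}"
      using \<open>finite U\<close> by (intro psubset_card_mono) auto
  qed (use p' that in auto)
  show ?case
  proof (cases "s = q")
    case True
    have "?R \<preceq> 1"
    proof (cases "p' = id")
      case True
      then have "(\<Prod>x\<in>U. m x (p' x)) = 1" by (simp add: diag)
      then show ?thesis using prod_p' \<open>s = q\<close> \<open>q \<in> U\<close> diag by simp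
    next
      case False
      from nu_less_imp_le[OF IH[OF this]] show ?thesis using prod_p' \<open>s = q\<close> \<open>q \<in> U\<close> diag by simp
    qed
    then have "(m q l * m l s) * ?R \<preceq> (m q l * m l s) * 1" by (rule nu_le_mult_left)
    also have "(m q l * m l s) * 1 \<prec> 1"
      using two_cycle[of q l] True \<open>q \<in> U\<close> \<open>q \<noteq> l\<close> l by simp
    finally show ?thesis unfolding prod_p .
  next
    case False
    then have "p' \<noteq> id" using p'_q by auto
    have "(m q l * m l s) * ?R \<preceq> m q s * ?R"
      using triangle[of q s l] \<open>q \<in> U\<close> s l by (intro nu_le_mult_right)
    also have "m q s * ?R \<prec> 1" using IH[OF \<open>p' \<noteq> id\<close>] unfolding prod_p' .
    finally show ?thesis unfolding prod_p .
  qed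
qed

text \<open>
  The strict inequality for 2-cycles serves twice: it makes the identity permutation dominate the
  determinant and the index \<open>k = i\<close> dominate the diagonal entries of the square. Off the diagonal the
  summand for \<open>k = i\<close> is the ghost \<open>M\<^sub>i\<^sub>j\<close> itself, which absorbs the others by the triangle inequality.
\<close>
lemma quasi_identityI:
  assumes M: "M \<in> carrier_mat n n"
    and diag: "\<And>i. i < n \<Longrightarrow> M $$ (i, i) = 1"
    and ghost: "\<And>i j. \<lbrakk>i < n; j < n; i \<noteq> j\<rbrakk> \<Longrightarrow> M $$ (i, j) \<in> G0"
    and triangle: "\<And>i j k. \<lbrakk>i < n; j < n; k < n\<rbrakk> \<Longrightarrow> M $$ (i, k) * M $$ (k, j) \<preceq> M $$ (i, j)"
    and two_cycle: "\<And>i k. \<lbrakk>i < n; k < n; i \<noteq> k\<rbrakk> \<Longrightarrow> M $$ (i, k) * M $$ (k, i) \<prec> 1"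
  shows "quasi_identity G0 n M"
proof -
  have id_prod: "(\<Prod>i = 0..<n. M $$ (i, id i)) = 1" using diag by simp
  have "(\<Prod>i = 0..<n. M $$ (i, p i)) \<prec> (\<Prod>i = 0..<n. M $$ (i, id i))"
    if "p permutes {0..<n}" "p \<noteq> id" for p
    unfolding id_prod using that diag triangle two_cycle
    by (intro perm_prod_nu_less_one[of "{0..<n}" "\<lambda>i j. M $$ (i, j)"]) auto
  then have "sdet M = (\<Prod>i = 0..<n. M $$ (i, id i))"
    unfolding sdet_carrier[OF M]
    by (intro sum_eq_dominant[where k = id and f = "\<lambda>p. \<Prod>i = 0..<n. M $$ (i, p i)"])
      (simp_all add: finite_permutations permutes_id del: id_apply)
  then have "nonsingular_mat G0 M"
    using tangible_one id_prod by (simp add: nonsingular_mat_def)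
  moreover have "M * M = M"
  proof (rule eq_matI)
    fix i j assume "i < dim_row M" "j < dim_col M"
    then have ij: "i < n" "j < n" using M by auto
    have "(\<Sum>k = 0..<n. M $$ (i, k) * M $$ (k, j)) = M $$ (i, j)"
    proof (cases "i = j")
      case True
      have "(\<Sum>k = 0..<n. M $$ (i, k) * M $$ (k, j)) = M $$ (i, i) * M $$ (i, j)"
        using ij True two_cycle diag by (intro sum_eq_dominant) auto
      then show ?thesis using diag ij by simp
    next
      case False
      have "(\<Sum>k = 0..<n. M $$ (i, k) * M $$ (k, j))
          = (\<Sum>k\<in>{0..<n} - {i}. M $$ (i, k) * M $$ (k, j)) + M $$ (i, j)"
        using ij diag by (simp add: sum.remove[of _ i] add.commute)
      also have "\<dots> = M $$ (i, j)"
        using ij False triangle ghost by (intro ghost_absorb sum_nu_le) auto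
      finally show ?thesis .
    qed
    then show "(M * M) $$ (i, j) = M $$ (i, j)" using mult_mat_entry[OF M M ij] by simp
  qed (use M in auto)
  ultimately show ?thesis using M diag ghost by (simp add: quasi_identity_def)
qed

end

section \<open>Normalized adjoints\<close>

context supertropical_domain
begin

lemma mult_nabla:
  assumes A: "A \<in> carrier_mat n n" and unit: "sdet A dvd 1" and hat: "tangible_retract G0 hat"
  shows "A * nabla A = A * tangible_nabla hat A" and "quasi_identity G0 n (A * nabla A)"
proof -
  have S: "sadj A \<in> carrier_mat n n" and T: "tangible_sadj hat A \<in> carrier_mat n n"
    using sadj_carrier[OF A] by (auto simp: tangible_sadj_def)
  define u where "u = unit_inverse (sdet A)"
  have u: "sdet A * u = 1" unfolding u_def using unit by (rule unit_inverse_right)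
  then have u_unit: "u dvd 1" by (metis dvd_triv_right)
  define N where "N = A * sadj A"
  have nabla: "A * nabla A = u \<cdot>\<^sub>m N"
    unfolding nabla_def N_def u_def by (rule mult_smult_distrib[OF A S])
  show "A * nabla A = A * tangible_nabla hat A"
    unfolding nabla unfolding N_def tangible_nabla_def u_def mult_smult_distrib[OF A T]
      mult_tangible_sadj[OF A unit hat] ..
  have N: "N \<in> carrier_mat n n" using A S by (simp add: N_def)
  have entry: "(u \<cdot>\<^sub>m N) $$ (i, j) = u * N $$ (i, j)" if "i < n" "j < n" for i j
    using N that by simp
  show "quasi_identity G0 n (A * nabla A)"
    unfolding nabla
  proof (rule quasi_identityI)
    show "u \<cdot>\<^sub>m N \<in> carrier_mat n n" using N by simp
  next
    fix i assume i: "i < n"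
    show "(u \<cdot>\<^sub>m N) $$ (i, i) = 1"
      unfolding entry[OF i i] using mult_sadj_diag[OF A i] u by (simp add: N_def mult.commute)
  next
    fix i j assume ij: "i < n" "j < n" "i \<noteq> j"
    have "N $$ (i, j) \<in> G0" unfolding N_def by (rule mult_sadj_offdiag_ghost[OF A ij S refl])
    then show "(u \<cdot>\<^sub>m N) $$ (i, j) \<in> G0" unfolding entry[OF ij(1,2)] by (rule ghost_mult_left)
  next
    fix i j k assume ijk: "i < n" "j < n" "k < n"
    have "u * u * (N $$ (i, k) * N $$ (k, j)) \<preceq> u * u * (sdet A * N $$ (i, j))"
      using mult_sadj_triangle[OF A ijk] unfolding N_def by (rule nu_le_mult_left)
    also have "u * u * (sdet A * N $$ (i, j)) = u * (sdet A * u) * N $$ (i, j)"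
      by (simp add: ac_simps)
    finally show "(u \<cdot>\<^sub>m N) $$ (i, k) * (u \<cdot>\<^sub>m N) $$ (k, j) \<preceq> (u \<cdot>\<^sub>m N) $$ (i, j)"
      unfolding u using ijk by (simp add: entry ac_simps del: index_smult_mat)
  next
    fix i k assume ik: "i < n" "k < n" "i \<noteq> k"
    have "u * (u * (N $$ (i, k) * N $$ (k, i))) \<prec> u * (u * (sdet A * sdet A))"
      using mult_sadj_two_cycle[OF A unit ik] unfolding N_def by (intro nu_less_mult_unit u_unit)
    also have "u * (u * (sdet A * sdet A)) = (sdet A * u) * (sdet A * u)"
      by (simp add: ac_simps)
    finally show "(u \<cdot>\<^sub>m N) $$ (i, k) * (u \<cdot>\<^sub>m N) $$ (k, i) \<prec> 1"
      unfolding u using ik by (simp add: entry ac_simps del: index_smult_mat)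
  qed
qed

end

lemma nabla_transpose:
  assumes A: "A \<in> carrier_mat n n"
  shows "nabla (transpose_mat A) = transpose_mat (nabla A)"
    and "tangible_nabla hat (transpose_mat A) = transpose_mat (tangible_nabla hat A)"
  by (auto simp: nabla_def tangible_nabla_def tangible_sadj_def sdet_transpose[OF A] sadj_transpose[OF A])

lemma quasi_identity_transpose:
  assumes "quasi_identity G0 n M"
  shows "quasi_identity G0 n (transpose_mat M)"
proof -
  have M: "M \<in> carrier_mat n n" using assms by (simp add: quasi_identity_def)
  have "transpose_mat M * transpose_mat M = transpose_mat M"
    using assms transpose_mult[OF M M] by (simp add: quasi_identity_def)
  then show ?thesis
    using assms M by (auto simp: quasi_identity_def nonsingular_mat_def sdet_transpose[OF M])
qed

theorem theorem2p8:
  fixes G0 :: "'a::comm_semiring_1 set"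
    and hat :: "'a \<Rightarrow> 'a"
    and A :: "'a mat"
    and n :: nat
  assumes "supertropical_domain G0"
    and "tangible_retract G0 hat"
    and "A \<in> carrier_mat n n"
    and "sdet A dvd 1"
  shows "A * nabla A = A * tangible_nabla hat A \<and>
         nabla A * A = tangible_nabla hat A * A \<and>
         quasi_identity G0 n (A * nabla A) \<and>
         quasi_identity G0 n (nabla A * A)"
proof -
  interpret supertropical_domain G0 by fact
  note A = assms(3)
  let ?B = "transpose_mat A"
  have B: "?B \<in> carrier_mat n n" "sdet ?B dvd 1"
    using A assms(4) sdet_transpose[OF A] by auto
  have nabla: "nabla A \<in> carrier_mat n n" and tnabla: "tangible_nabla hat A \<in> carrier_mat n n"
    using sadj_carrier[OF A] by (auto simp: nabla_def tangible_nabla_def tangible_sadj_def)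
  have swap: "nabla A * A = transpose_mat (?B * nabla ?B)"
    "tangible_nabla hat A * A = transpose_mat (?B * tangible_nabla hat ?B)"
    unfolding nabla_transpose[OF A]
    by (simp_all flip: transpose_mult[OF nabla A] transpose_mult[OF tnabla A])
  have "nabla A * A = tangible_nabla hat A * A"
    unfolding swap mult_nabla(1)[OF B assms(2)] ..
  moreover have "quasi_identity G0 n (nabla A * A)"
    unfolding swap by (intro quasi_identity_transpose mult_nabla(2)[OF B assms(2)])
  ultimately show ?thesis using mult_nabla[OF A assms(4,2)] by blast
qed

end
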